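(* Let $0<\alpha<1$, $L>0$, $T>0$, $\nu>0$, let $u_0$ be a sufficiently smooth function on $[0,L]$, and let $u(x,t)$ be a classical solution of the time-fractional Burgers equation $$\partial^\alpha_{+0,t}u+uu_x=\nu u_{xx},\quad x\in(0,L),\ t>0,\qquad u(x,0)=u_0(x),\ x\in[0,L].$$ Then $$u(x,t)\le\max_{(x,t)}\{u(L,t),\,u(0,t),\,u(x,0)\}\quad\text{for }(x,t)\in[0,L]\times[0,T),$$ where the maximum is taken over all the values $u(0,t)$, $u(L,t)$ with $t\in[0,T)$ and $u(x,0)$ with $x\in[0,L]$.
   Context: $\partial_{+0,t}^\alpha$ is the Caputo derivative of order $\alpha\in(0,1)$ in $t$: $\partial_{+0}^\alpha f(t)=\frac{d}{dt}\frac{1}{\Gamma(1-\alpha)}\int_0^t(t-s)^{-\alpha}(f(s)-f(0))\,ds$, which for $f\in C^1$ equals $\frac{1}{\Gamma(1-\alpha)}\int_0^t(t-s)^{-\alpha}f'(s)\,ds$. A classical solution is one that is continuous up to the boundary, continuously differentiable in $t$ and twice continuously differentiable in $x$, satisfying the equation pointwise. *)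

theory Defs
  imports "HOL-Analysis.Analysis"
begin

definition frac_integral :: "real \<Rightarrow> (real \<Rightarrow> real) \<Rightarrow> real \<Rightarrow> real" where
  "frac_integral \<alpha> f t =
     1 / Gamma (1 - \<alpha>) * integral {0..t} (\<lambda>s. (t - s) powr (- \<alpha>) * (f s - f 0))"

text \<open>As \<^const>\<open>deriv\<close> is total, the value is meaningful only where
  \<^const>\<open>frac_integral\<close> is differentiable in its last argument.\<close>

definition caputo_deriv :: "real \<Rightarrow> (real \<Rightarrow> real) \<Rightarrow> real \<Rightarrow> real" where
  "caputo_deriv \<alpha> f t = deriv (frac_integral \<alpha> f) t"

text \<open>\<open>Ck_on k f S\<close>: \<open>f\<close> is \<open>k\<close> times continuously differentiable on \<open>S\<close>, with one-sided
  derivatives at the end points if \<open>S\<close> is a compact interval; \<open>g i\<close> is the \<open>i\<close>-th derivative.\<close>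

definition Ck_on :: "nat \<Rightarrow> (real \<Rightarrow> real) \<Rightarrow> real set \<Rightarrow> bool" where
  "Ck_on k f S \<longleftrightarrow> (\<exists>g :: nat \<Rightarrow> real \<Rightarrow> real.
     (\<forall>x\<in>S. g 0 x = f x) \<and>
     (\<forall>i<k. \<forall>x\<in>S. (g i has_real_derivative g (Suc i) x) (at x within S)) \<and>
     (\<forall>i\<le>k. continuous_on S (g i)))"

text \<open>The function \<open>u\<close> takes the space variable first. Derivatives are required, and required to be
  jointly continuous, only in the open set \<open>{0<..<L} \<times> {0<..}\<close>; up to the boundary
  only \<open>u\<close> itself is continuous.\<close>

definition frac_burgers_classical_solution ::
  "real \<Rightarrow> real \<Rightarrow> real \<Rightarrow> (real \<Rightarrow> real) \<Rightarrow> (real \<Rightarrow> real \<Rightarrow> real) \<Rightarrow> bool" where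
  "frac_burgers_classical_solution \<alpha> L \<nu> u\<^sub>0 u \<longleftrightarrow>
     continuous_on ({0..L} \<times> {0..}) (\<lambda>(x, t). u x t) \<and>
     (\<forall>x\<in>{0<..<L}. \<forall>t>0. (\<lambda>s. u x s) differentiable (at t)) \<and>
     continuous_on ({0<..<L} \<times> {0<..}) (\<lambda>(x, t). deriv (\<lambda>s. u x s) t) \<and>
     (\<forall>x\<in>{0<..<L}. \<forall>t>0. (\<lambda>y. u y t) differentiable (at x)) \<and>
     continuous_on ({0<..<L} \<times> {0<..}) (\<lambda>(x, t). deriv (\<lambda>y. u y t) x) \<and>
     (\<forall>x\<in>{0<..<L}. \<forall>t>0. deriv (\<lambda>y. u y t) differentiable (at x)) \<and>
     continuous_on ({0<..<L} \<times> {0<..}) (\<lambda>(x, t). deriv (deriv (\<lambda>y. u y t)) x) \<and>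
     (\<forall>x\<in>{0<..<L}. \<forall>t>0.
        frac_integral \<alpha> (\<lambda>s. u x s) differentiable (at t) \<and>
        caputo_deriv \<alpha> (\<lambda>s. u x s) t + u x t * deriv (\<lambda>y. u y t) x
          = \<nu> * deriv (deriv (\<lambda>y. u y t)) x) \<and>
     (\<forall>x\<in>{0..L}. u x 0 = u\<^sub>0 x)"

definition parabolic_boundary_values ::
  "real \<Rightarrow> real \<Rightarrow> (real \<Rightarrow> real \<Rightarrow> real) \<Rightarrow> real set" where
  "parabolic_boundary_values L T u =
     (\<lambda>t. u L t) ` {0..<T} \<union> (\<lambda>t. u 0 t) ` {0..<T} \<union> (\<lambda>x. u x 0) ` {0..L}"

text \<open>The values are bounded, so their \<^const>\<open>Sup\<close> is a genuine least upper bound. It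
  need not be attained, since \<open>{0..<T}\<close> is not compact.\<close>

lemma bdd_above_parabolic_boundary_values:
  assumes "L > 0" and "frac_burgers_classical_solution \<alpha> L \<nu> u\<^sub>0 u"
  shows "bdd_above (parabolic_boundary_values L T u)"
proof -
  let ?f = "\<lambda>(x, t). u x t"
  have "continuous_on ({0..L} \<times> {0..max T 0}) ?f"
    using assms(2) unfolding frac_burgers_classical_solution_def
    by (auto elim: continuous_on_subset)
  then have "compact (?f ` ({0..L} \<times> {0..max T 0}))"
    by (intro compact_continuous_image compact_Times) auto
  then have "bdd_above (?f ` ({0..L} \<times> {0..max T 0}))"
    by (intro bounded_imp_bdd_above compact_imp_bounded)
  moreover have "parabolic_boundary_values L T u \<subseteq> ?f ` ({0..L} \<times> {0..max T 0})"
    using assms(1) unfolding parabolic_boundary_values_def by force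
  ultimately show ?thesis
    by (rule bdd_above_mono)
qed

end

theory Submission
  imports Defs
begin

text \<open>Above its parabolic boundary values, \<open>u\<close> would have a maximum over
  \<open>{0..L} \<times> {0..t}\<close> at some \<open>(x\<^sub>0, t\<^sub>0)\<close> off the parabolic boundary. There \<open>u\<^sub>x = 0\<close> and
  \<open>u\<^sub>x\<^sub>x \<le> 0\<close>, so the equation makes the Caputo derivative nonpositive. But with
  \<open>f s = u x\<^sub>0 s\<close> the Caputo derivative at a maximum is at least
  \<open>t\<^sub>0\<close> powr \<open>(- \<alpha>) * (f t\<^sub>0 - f 0) / Gamma (1 - \<alpha>) > 0\<close>, because the kernel
  \<open>(t - s)\<close> powr \<open>(- \<alpha>)\<close> decreases in \<open>t\<close> and \<open>f t\<^sub>0 - f s\<close> is nonnegative and \<open>O(t\<^sub>0 - s)\<close>.\<close>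

lemma has_integral_abel_kernel:
  fixes \<alpha> a b :: real
  assumes "\<alpha> < 1" and "a \<le> b"
  shows "((\<lambda>s. (b - s) powr (- \<alpha>)) has_integral (b - a) powr (1 - \<alpha>) / (1 - \<alpha>)) {a..b}"
proof -
  let ?P = "\<lambda>s. - ((b - s) powr (1 - \<alpha>) / (1 - \<alpha>))"
  have "((\<lambda>s. (b - s) powr (- \<alpha>)) has_integral (?P b - ?P a)) {a..b}"
  \<comment> \<open>For \<alpha> > 0 the kernel is unbounded near \<open>b\<close>, so the
    derivative is taken only in the open interval; \<open>?P\<close> stays continuous at
    \<open>b\<close> because \<open>1 - \<alpha>\<close> is positive.\<close>
  proof (rule fundamental_theorem_of_calculus_interior)
    show "continuous_on {a..b} ?P"
      using assms by (intro continuous_intros continuous_on_powr') auto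
    fix s assume "s \<in> {a<..<b}"
    then show "(?P has_vector_derivative (b - s) powr (- \<alpha>)) (at s)"
      unfolding has_real_derivative_iff_has_vector_derivative [symmetric]
      using assms by (auto intro!: derivative_eq_intros)
  qed fact
  then show ?thesis by simp
qed

text \<open>The kernel is nonnegative, hence absolutely integrable, and this survives multiplication
  by a bounded measurable factor.\<close>

lemma abel_kernel_times_continuous_integrable:
  fixes \<alpha> a b :: real and f :: "real \<Rightarrow> real"
  assumes "\<alpha> < 1" and "a \<le> b" and "continuous_on {a..b} f"
  shows "(\<lambda>s. (b - s) powr (- \<alpha>) * f s) integrable_on {a..b}"
proof -
  have "(\<lambda>s. (b - s) powr (- \<alpha>)) absolutely_integrable_on {a..b}"
    using has_integral_abel_kernel [OF assms(1,2)]
    by (intro nonnegative_absolutely_integrable_1) auto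
  moreover have "bounded (f ` {a..b})"
    by (intro compact_imp_bounded compact_continuous_image assms) auto
  moreover have "f \<in> borel_measurable (lebesgue_on {a..b})"
    using assms(3) by (intro continuous_imp_measurable_on_sets_lebesgue) auto
  ultimately have "(\<lambda>s. f s * (b - s) powr (- \<alpha>)) absolutely_integrable_on {a..b}"
    by (intro absolutely_integrable_bounded_measurable_product_real) auto
  then show ?thesis
    by (simp add: mult.commute set_lebesgue_integral_eq_integral(1))
qed

text \<open>Cut \<open>J t\<close> at \<open>t - h\<close>. The left piece is at most
  \<open>J (t - h)\<close> by monotonicity of the kernel; on the right piece \<open>K * h\<close>
  bounds the density and the kernel has mass \<open>h powr (1 - \<alpha>) / (1 - \<alpha>)\<close>.
  The resulting bound is o(h).\<close>

lemma abel_integral_increment_le: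
  fixes \<alpha> K h t :: real and \<phi> :: "real \<Rightarrow> real"
  defines "J \<equiv> \<lambda>t. integral {0..t} (\<lambda>s. (t - s) powr (- \<alpha>) * \<phi> s)"
  assumes \<alpha>: "0 < \<alpha>" "\<alpha> < 1" and h: "0 < h" "h \<le> t"
    and cont: "continuous_on {0..t} \<phi>"
    and nonneg: "\<And>s. s \<in> {0..t} \<Longrightarrow> 0 \<le> \<phi> s"
    and bound: "\<And>s. s \<in> {t - h..t} \<Longrightarrow> \<phi> s \<le> K * h"
  shows "J t - J (t - h) \<le> h * (K * h powr (1 - \<alpha>) / (1 - \<alpha>))"
proof -
  let ?k = "\<lambda>s. (t - s) powr (- \<alpha>) * \<phi> s"
  have int: "?k integrable_on {0..t}"
    using abel_kernel_times_continuous_integrable [OF \<alpha>(2) _ cont] h by simp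
  have split: "J t = integral {0..t - h} ?k + integral {t - h..t} ?k"
    unfolding J_def
    using Henstock_Kurzweil_Integration.integral_combine [of 0 "t - h" t ?k] h int by simp
  have int_left: "?k integrable_on {0..t - h}" and int_right: "?k integrable_on {t - h..t}"
    using h by (auto intro!: integrable_subinterval_real [OF int])
  \<comment> \<open>At \<open>s = t - h\<close> the kernel of \<open>J (t - h)\<close> has the junk value \<open>0 powr (- \<alpha>) = 0\<close>.\<close>
  let ?m = "\<lambda>s. if s = t - h then 0 else ?k s"
  have spike: "integral {0..t - h} ?k = integral {0..t - h} ?m"
    by (rule integral_spike [of "{t - h}"]) auto
  have left: "integral {0..t - h} ?m \<le> J (t - h)"
    unfolding J_def
  proof (rule integral_le)
    show "?m integrable_on {0..t - h}"
      by (rule integrable_spike [OF int_left, of "{t - h}"]) auto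
    show "(\<lambda>s. (t - h - s) powr (- \<alpha>) * \<phi> s) integrable_on {0..t - h}"
      using h \<alpha> by (intro abel_kernel_times_continuous_integrable continuous_on_subset [OF cont]) auto
    fix s assume s: "s \<in> {0..t - h}"
    show "?m s \<le> (t - h - s) powr (- \<alpha>) * \<phi> s"
    proof (cases "s = t - h")
      case False
      then have "(t - s) powr (- \<alpha>) \<le> (t - h - s) powr (- \<alpha>)"
        using s h \<alpha> by (intro powr_mono2') auto
      then show ?thesis
        using False s h nonneg by (auto intro!: mult_right_mono)
    qed simp
  qed
  have "((\<lambda>s. (t - s) powr (- \<alpha>) * (K * h)) has_integral
      h powr (1 - \<alpha>) / (1 - \<alpha>) * (K * h)) {t - h..t}"
    using has_integral_mult_left [OF has_integral_abel_kernel [of \<alpha> "t - h" t]] \<alpha> h by simp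
  then have right: "integral {t - h..t} ?k \<le> h powr (1 - \<alpha>) / (1 - \<alpha>) * (K * h)"
  proof (rule has_integral_le [OF integrable_integral [OF int_right]])
    show "?k s \<le> (t - s) powr (- \<alpha>) * (K * h)" if "s \<in> {t - h..t}" for s
      using bound [OF that] by (intro mult_left_mono) simp_all
  qed
  have "J t - J (t - h) \<le> integral {t - h..t} ?k"
    using split spike left by linarith
  also note right
  also have "h powr (1 - \<alpha>) / (1 - \<alpha>) * (K * h) = h * (K * h powr (1 - \<alpha>) / (1 - \<alpha>))"
    by simp
  finally show ?thesis .
qed

text \<open>Split \<open>f s - f 0\<close> as \<open>(f t - f 0) - (f t - f s)\<close>. The
  reference point \<open>t\<close> stays fixed while \<open>r\<close> varies, so the first part is
  an explicit power of \<open>r\<close>; at a maximum \<open>t\<close> the second density is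
  nonnegative.\<close>

lemma frac_integral_conv_abel_integral:
  fixes \<alpha> r t :: real and f :: "real \<Rightarrow> real"
  assumes \<alpha>: "\<alpha> < 1" and r: "0 \<le> r" and cont: "continuous_on {0..r} f"
  shows "Gamma (1 - \<alpha>) * frac_integral \<alpha> f r =
    r powr (1 - \<alpha>) / (1 - \<alpha>) * (f t - f 0)
      - integral {0..r} (\<lambda>s. (r - s) powr (- \<alpha>) * (f t - f s))"
proof -
  have "Gamma (1 - \<alpha>) > 0"
    using \<alpha> by (intro Gamma_real_pos) auto
  then have "Gamma (1 - \<alpha>) * frac_integral \<alpha> f r
      = integral {0..r} (\<lambda>s. (r - s) powr (- \<alpha>) * (f s - f 0))"
    by (simp add: frac_integral_def)
  also have "\<dots> = integral {0..r} (\<lambda>s. (r - s) powr (- \<alpha>) * (f t - f 0)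
      - (r - s) powr (- \<alpha>) * (f t - f s))"
    by (simp add: algebra_simps)
  also have "\<dots> = integral {0..r} (\<lambda>s. (r - s) powr (- \<alpha>) * (f t - f 0))
      - integral {0..r} (\<lambda>s. (r - s) powr (- \<alpha>) * (f t - f s))"
    using \<alpha> r cont
    by (intro integral_diff abel_kernel_times_continuous_integrable continuous_intros)
  also have "integral {0..r} (\<lambda>s. (r - s) powr (- \<alpha>) * (f t - f 0))
      = r powr (1 - \<alpha>) / (1 - \<alpha>) * (f t - f 0)"
    using has_integral_mult_left [OF has_integral_abel_kernel [of \<alpha> 0 r]] \<alpha> r
    by (intro integral_unique) auto
  finally show ?thesis .
qed

text \<open>Near \<open>t\<close> the difference quotient is below \<open>D + 1\<close>, which
  serves as \<open>K\<close> and may be negative.\<close>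

lemma differentiable_imp_left_lipschitz:
  fixes f :: "real \<Rightarrow> real"
  assumes "f differentiable (at t)"
  obtains K d where "d > 0" and "\<And>s. \<lbrakk>t - d < s; s \<le> t\<rbrakk> \<Longrightarrow> f t - f s \<le> K * (t - s)"
proof -
  obtain D where "(f has_real_derivative D) (at t)"
    using assms real_differentiable_def by blast
  then have "((\<lambda>s. (f s - f t) / (s - t)) \<longlongrightarrow> D) (at t)"
    by (simp add: has_field_derivative_iff)
  from LIM_D [OF this, of 1] obtain d where d: "d > 0"
    "\<And>s. s \<noteq> t \<Longrightarrow> \<bar>s - t\<bar> < d \<Longrightarrow> \<bar>(f s - f t) / (s - t) - D\<bar> < 1"
    by auto
  have "f t - f s \<le> (D + 1) * (t - s)" if "t - d < s" "s \<le> t" for s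
  proof (cases "s = t")
    case False
    then have "(f s - f t) / (s - t) < D + 1"
      using d(2) [of s] that by auto
    then show ?thesis
      using False that by (auto simp: field_simps)
  qed simp
  with d(1) that show thesis by blast
qed

text \<open>The explicit power term differentiates to the claimed bound. The remainder
  \<open>J\<close> is subtracted, and its left increments at \<open>t\<close> are at most o(h), so
  its left derivative is nonpositive.\<close>

lemma caputo_deriv_at_max_ge:
  fixes \<alpha> t :: real and f :: "real \<Rightarrow> real"
  assumes \<alpha>: "0 < \<alpha>" "\<alpha> < 1" and t: "t > 0"
    and cont: "continuous_on {0..t} f"
    and diff: "f differentiable (at t)"
    and frac: "frac_integral \<alpha> f differentiable (at t)"
    and max: "\<And>s. s \<in> {0..t} \<Longrightarrow> f s \<le> f t"
  shows "t powr (- \<alpha>) * (f t - f 0) / Gamma (1 - \<alpha>) \<le> caputo_deriv \<alpha> f t"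
proof -
  define J where "J = (\<lambda>r. integral {0..r} (\<lambda>s. (r - s) powr (- \<alpha>) * (f t - f s)))"
  let ?\<Gamma> = "Gamma (1 - \<alpha>)"
  \<comment> \<open>\<open>f\<close> is controlled only on \<open>{0..t}\<close>, so
    \<open>J\<close> is not differentiated directly: \<open>G\<close> has the two-sided derivative
    \<open>D\<close> at \<open>t\<close> by \<open>frac\<close>, and agrees with \<open>J\<close> on
    \<open>{0..t}\<close>, which suffices for left quotients.\<close>
  define G where "G = (\<lambda>r. r powr (1 - \<alpha>) / (1 - \<alpha>) * (f t - f 0) - ?\<Gamma> * frac_integral \<alpha> f r)"
  define D where "D = t powr (- \<alpha>) * (f t - f 0) - ?\<Gamma> * caputo_deriv \<alpha> f t"
  have G_eq: "G r = J r" if "r \<in> {0..t}" for r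
    unfolding G_def J_def
    using frac_integral_conv_abel_integral [of \<alpha> r f t] \<alpha> that continuous_on_subset [OF cont, of "{0..r}"]
    by auto
  have "(frac_integral \<alpha> f has_real_derivative caputo_deriv \<alpha> f t) (at t)"
    using frac unfolding caputo_deriv_def
    by (simp add: DERIV_deriv_iff_real_differentiable)
  then have "(G has_real_derivative D) (at t)"
    unfolding G_def D_def using \<alpha> t
    by (auto intro!: derivative_eq_intros)
  then have "((\<lambda>h. (G (t + h) - G t) / h) \<longlongrightarrow> D) (at_left 0)"
    unfolding DERIV_def by (rule tendsto_mono [rotated]) (simp add: at_le)
  then have lim: "((\<lambda>h. (G (t - h) - G t) / (- h)) \<longlongrightarrow> D) (at_right 0)"
    by (simp add: filterlim_at_left_to_right)
  obtain K d where d: "d > 0" "\<And>s. \<lbrakk>t - d < s; s \<le> t\<rbrakk> \<Longrightarrow> f t - f s \<le> K * (t - s)"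
    using differentiable_imp_left_lipschitz [OF diff] by metis
  have bound: "(G (t - h) - G t) / (- h) \<le> \<bar>K\<bar> * h powr (1 - \<alpha>) / (1 - \<alpha>)"
    if h: "0 < h" "h < min d t" for h
  proof -
    have "f t - f s \<le> \<bar>K\<bar> * h" if s: "s \<in> {t - h..t}" for s
    proof -
      have "f t - f s \<le> K * (t - s)"
        using d(2) s h by auto
      also have "\<dots> \<le> \<bar>K\<bar> * h"
        using s by (intro mult_mono) auto
      finally show ?thesis .
    qed
    then have "J t - J (t - h) \<le> h * (\<bar>K\<bar> * h powr (1 - \<alpha>) / (1 - \<alpha>))"
      unfolding J_def using \<alpha> h max cont
      by (intro abel_integral_increment_le) (auto intro!: continuous_intros)
    moreover have "G t = J t" "G (t - h) = J (t - h)"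
      using h by (auto intro: G_eq)
    ultimately have "(G t - G (t - h)) / h \<le> \<bar>K\<bar> * h powr (1 - \<alpha>) / (1 - \<alpha>)"
      using h(1) by (simp add: pos_divide_le_eq mult.commute)
    then show ?thesis
      by (simp add: minus_divide_left)
  qed
  \<comment> \<open>The limit is 0, since \<open>0 powr (1 - \<alpha>) = 0\<close>; convergence to
    it rests on \<alpha> < 1.\<close>
  have "((\<lambda>h. \<bar>K\<bar> * h powr (1 - \<alpha>) / (1 - \<alpha>)) \<longlongrightarrow> \<bar>K\<bar> * 0 powr (1 - \<alpha>) / (1 - \<alpha>)) (at_right 0)"
    using \<alpha> by (intro tendsto_intros tendsto_powr') (auto simp: eventually_at_filter)
  moreover have "\<forall>\<^sub>F h in at_right 0. (G (t - h) - G t) / (- h) \<le> \<bar>K\<bar> * h powr (1 - \<alpha>) / (1 - \<alpha>)"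
    using bound d(1) t by (auto simp: eventually_at_right intro!: exI [of _ "min d t"])
  ultimately have "D \<le> 0"
    using lim by (auto dest: tendsto_le [OF trivial_limit_at_right_real])
  moreover have "?\<Gamma> > 0"
    using \<alpha> by (intro Gamma_real_pos) auto
  ultimately show ?thesis
    unfolding D_def by (simp add: pos_divide_le_eq mult.commute)
qed

text \<open>Were the second derivative positive, the first, zero at \<open>x\<close>, would be
  positive just to the right, and the mean value theorem would give a larger value of
  \<open>f\<close> there.\<close>

lemma second_deriv_nonpos_at_local_max:
  fixes f :: "real \<Rightarrow> real"
  assumes ab: "x \<in> {a<..<b}"
    and diff: "\<And>y. y \<in> {a<..<b} \<Longrightarrow> f differentiable (at y)"
    and diff2: "deriv f differentiable (at x)"
    and max: "\<And>y. y \<in> {a<..<b} \<Longrightarrow> f y \<le> f x"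
  shows "deriv f x = 0" and "deriv (deriv f) x \<le> 0"
proof -
  have D: "(f has_real_derivative deriv f y) (at y)" if "y \<in> {a<..<b}" for y
    using diff [OF that] by (simp add: DERIV_deriv_iff_real_differentiable)
  show zero: "deriv f x = 0"
  proof (rule DERIV_local_max [OF D [OF ab], of "min (x - a) (b - x)"])
    show "\<forall>y. \<bar>x - y\<bar> < min (x - a) (b - x) \<longrightarrow> f y \<le> f x"
    proof (intro allI impI max)
      fix y assume "\<bar>x - y\<bar> < min (x - a) (b - x)"
      then show "y \<in> {a<..<b}" by (simp add: abs_less_iff)
    qed
  qed (use ab in simp)
  show "deriv (deriv f) x \<le> 0"
  proof (rule ccontr)
    assume "\<not> deriv (deriv f) x \<le> 0"
    then obtain d where d: "d > 0" "\<And>h. 0 < h \<Longrightarrow> h < d \<Longrightarrow> deriv f x < deriv f (x + h)"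
      using DERIV_pos_inc_right [of "deriv f" "deriv (deriv f) x" x] diff2
      by (auto simp: DERIV_deriv_iff_real_differentiable)
    define y where "y = x + min d (b - x) / 2"
    have y: "x < y" "y < x + d" "y < b"
      using d(1) ab by (auto simp: y_def min_def field_simps)
    obtain z where "x < z" "z < y" "f y - f x = (y - x) * deriv f z"
      using MVT2 [of x y f "deriv f"] D y ab by force
    moreover have "deriv f z > 0"
      using d(2) [of "z - x"] zero y calculation by auto
    ultimately have "f y > f x"
      using y by (metis diff_gt_0_iff_gt mult_pos_pos)
    with max [of y] y ab show False by auto
  qed
qed

theorem theorem6p2:
  fixes \<alpha> L T \<nu> :: real and u\<^sub>0 :: "real \<Rightarrow> real" and u :: "real \<Rightarrow> real \<Rightarrow> real"
    and k :: nat
  assumes "0 < \<alpha>" and "\<alpha> < 1" and "L > 0" and "T > 0" and "\<nu> > 0"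
    and "Ck_on k u\<^sub>0 {0..L}"
    and "frac_burgers_classical_solution \<alpha> L \<nu> u\<^sub>0 u"
  shows "\<forall>x\<in>{0..L}. \<forall>t\<in>{0..<T}. u x t \<le> Sup (parabolic_boundary_values L T u)"
proof (intro ballI, rule ccontr)
  fix x t assume x: "x \<in> {0..L}" and t: "t \<in> {0..<T}"
  let ?B = "parabolic_boundary_values L T u"
  assume "\<not> u x t \<le> Sup ?B"
  then have above: "v < u x t" if "v \<in> ?B" for v
    using cSup_upper [OF that bdd_above_parabolic_boundary_values [OF assms(3,7)]] by simp
  note sol = assms(7) [unfolded frac_burgers_classical_solution_def]
  from sol have cont: "continuous_on ({0..L} \<times> {0..}) (\<lambda>(x, t). u x t)"
    by blast
  \<comment> \<open>Stopping at the given \<open>t\<close> < \<open>T\<close> makes the rectangle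
    compact and keeps its parabolic boundary values inside \<open>?B\<close>.\<close>
  have "\<exists>p\<in>{0..L} \<times> {0..t}. \<forall>q\<in>{0..L} \<times> {0..t}. (\<lambda>(x, t). u x t) q \<le> (\<lambda>(x, t). u x t) p"
    using x t by (intro continuous_attains_sup compact_Times continuous_on_subset [OF cont]) auto
  then obtain y r where y: "y \<in> {0..L}" and r: "r \<in> {0..t}"
    and max: "\<And>z s. z \<in> {0..L} \<Longrightarrow> s \<in> {0..t} \<Longrightarrow> u z s \<le> u y r"
    by auto
  have "u y r \<notin> ?B"
    using above max [of x t] x t by force
  then have "y \<noteq> 0" "y \<noteq> L" "r \<noteq> 0"
    using y r t by (auto simp: parabolic_boundary_values_def)
  with y r have yr: "y \<in> {0<..<L}" "r > 0" by auto
  \<comment> \<open>This strict gap makes the Caputo derivative strictly positive, where a classical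
    time derivative would only be nonnegative.\<close>
  have "u y 0 < u y r"
    using above [of "u y 0"] max [of x t] x y t by (force simp: parabolic_boundary_values_def)
  then have "0 < r powr (- \<alpha>) * (u y r - u y 0) / Gamma (1 - \<alpha>)"
    using assms yr by (intro divide_pos_pos mult_pos_pos Gamma_real_pos) auto
  also have "\<dots> \<le> caputo_deriv \<alpha> (u y) r"
  proof (rule caputo_deriv_at_max_ge)
    show "continuous_on {0..r} (u y)"
    proof -
      have "continuous_on {0..r} (\<lambda>s. (y, s))"
        by (intro continuous_intros)
      moreover have "(\<lambda>s. (y, s)) ` {0..r} \<subseteq> {0..L} \<times> {0..}"
        using y by auto
      ultimately show ?thesis
        using continuous_on_compose2 [OF cont, of "{0..r}" "\<lambda>s. (y, s)"] by simp
    qed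
  qed (use assms sol yr max y r in auto)
  finally have "0 < caputo_deriv \<alpha> (u y) r" .
  \<comment> \<open>The vanishing slope removes the convection term whatever the sign of
    \<open>u y r\<close>.\<close>
  moreover have "deriv (\<lambda>z. u z r) y = 0" "deriv (deriv (\<lambda>z. u z r)) y \<le> 0"
    using sol yr max r
    by (auto intro!: second_deriv_nonpos_at_local_max [of y 0 L])
  moreover have "caputo_deriv \<alpha> (u y) r + u y r * deriv (\<lambda>z. u z r) y
      = \<nu> * deriv (deriv (\<lambda>z. u z r)) y"
    using sol yr by blast
  ultimately have "0 < \<nu> * deriv (deriv (\<lambda>z. u z r)) y"
    by simp
  with \<open>deriv (deriv (\<lambda>z. u z r)) y \<le> 0\<close> assms(5) show False
    by (simp add: zero_less_mult_iff)
qed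

end
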